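(* Let $X$ be a Hilbert space, $m \geq 1$ and $R_1,\ldots,R_m:X \to X$ be supercoercively super strongly nonexpansive mappings which have the approximate fixed point property. Then $R_m \circ\ldots\circ R_1$ is asymptotically regular.
   Context: Let $X$ be a Hilbert space and $T:X\to X$. $T$ is nonexpansive if $\|Tx-Ty\|\le\|x-y\|$ for all $x,y\in X$. $T$ is super strongly nonexpansive if it is nonexpansive and, for all sequences $(x_n),(y_n)\subseteq X$ with $\lim_{n\to\infty}(\|x_n-y_n\|^2-\|Tx_n-Ty_n\|^2)=0$, one has $\lim_{n\to\infty}((x_n-y_n)-(Tx_n-Ty_n))=0$. A function $\chi:(0,\infty)\to(0,\infty)$ is an SSNE-modulus for $T$ if for every $\varepsilon>0$ and all $x,y\in X$ with $\|x-y\|^2-\|Tx-Ty\|^2<\chi(\varepsilon)$ one has $\|(x-y)-(Tx-Ty)\|<\varepsilon$. $T$ is supercoercively super strongly nonexpansive if it is super strongly nonexpansive and admits an SSNE-modulus $\chi$ such that $\lim_{s\to\infty}\chi(s)/s=\infty$. $T$ has the approximate fixed point property if for every $\varepsilon>0$ there is a $p\in X$ with $\|p-Tp\|\le\varepsilon$. $T$ is asymptotically regular if for every $x\in X$, $\lim_{n\to\infty}\|T^nx-T^{n+1}x\|=0$. *)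

theory Defs
  imports "HOL-Analysis.Analysis"
begin

definition nonexpansive :: "('a::real_inner \<Rightarrow> 'a) \<Rightarrow> bool" where
  "nonexpansive T \<longleftrightarrow> (\<forall>x y. norm (T x - T y) \<le> norm (x - y))"

definition super_strongly_nonexpansive :: "('a::real_inner \<Rightarrow> 'a) \<Rightarrow> bool" where
  "super_strongly_nonexpansive T \<longleftrightarrow>
     nonexpansive T \<and>
     (\<forall>x y :: nat \<Rightarrow> 'a.
        (\<lambda>n. (norm (x n - y n))\<^sup>2 - (norm (T (x n) - T (y n)))\<^sup>2) \<longlonglongrightarrow> 0 \<longrightarrow>
        (\<lambda>n. (x n - y n) - (T (x n) - T (y n))) \<longlonglongrightarrow> 0)"

(* A modulus is a function from the positive reals to the positive reals; it is represented by
   a total function whose values at nonpositive arguments are irrelevant. *)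
definition SSNE_modulus :: "(real \<Rightarrow> real) \<Rightarrow> ('a::real_inner \<Rightarrow> 'a) \<Rightarrow> bool" where
  "SSNE_modulus \<psi> T \<longleftrightarrow>
     (\<forall>\<epsilon>>0. \<psi> \<epsilon> > 0) \<and>
     (\<forall>\<epsilon>>0. \<forall>x y. (norm (x - y))\<^sup>2 - (norm (T x - T y))\<^sup>2 < \<psi> \<epsilon> \<longrightarrow>
        norm ((x - y) - (T x - T y)) < \<epsilon>)"

definition supercoercively_SSNE :: "('a::real_inner \<Rightarrow> 'a) \<Rightarrow> bool" where
  "supercoercively_SSNE T \<longleftrightarrow>
     super_strongly_nonexpansive T \<and>
     (\<exists>\<psi>. SSNE_modulus \<psi> T \<and> filterlim (\<lambda>s. \<psi> s / s) at_top at_top)"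

definition approx_fixed_point_property :: "('a::real_inner \<Rightarrow> 'a) \<Rightarrow> bool" where
  "approx_fixed_point_property T \<longleftrightarrow> (\<forall>\<epsilon>>0. \<exists>p. norm (p - T p) \<le> \<epsilon>)"

definition asymptotically_regular :: "('a::real_inner \<Rightarrow> 'a) \<Rightarrow> bool" where
  "asymptotically_regular T \<longleftrightarrow>
     (\<forall>x. (\<lambda>n. norm ((T ^^ n) x - (T ^^ Suc n) x)) \<longlonglongrightarrow> 0)"

(* The composition R m \<circ> \<dots> \<circ> R 1, with R 1 applied first. *)
primrec composition_upto :: "(nat \<Rightarrow> 'a \<Rightarrow> 'a) \<Rightarrow> nat \<Rightarrow> 'a \<Rightarrow> 'a" where
  "composition_upto R 0 = id"
| "composition_upto R (Suc m) = R (Suc m) \<circ> composition_upto R m"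

end

theory Submission
  imports Defs
begin

text \<open>
  Supercoercivity makes \<open>\<parallel>x - y\<parallel>\<^sup>2 - \<parallel>T x - T y\<parallel>\<^sup>2\<close> dominate every multiple of
  \<open>\<parallel>(x - y) - (T x - T y)\<parallel>\<close> up to a constant. Taking for \<open>y\<close> an approximate fixed point and
  expanding the squares, this yields that for every \<open>\<epsilon> > 0\<close> there is a \<open>C\<close> with
  \<open>\<parallel>T x\<parallel>\<^sup>2 \<le> \<parallel>x\<parallel>\<^sup>2 + \<epsilon> \<parallel>x\<parallel> + C\<close> for all \<open>x\<close>. This norm bound is stable under composition, and
  for a nonexpansive map it gives back approximate fixed points: the solution \<open>x\<close> of
  \<open>(1 + \<delta>) x = T x\<close> satisfies \<open>2 \<delta> \<parallel>x\<parallel>\<^sup>2 \<le> \<epsilon> \<parallel>x\<parallel> + C\<close>, so \<open>\<parallel>x - T x\<parallel> = \<delta> \<parallel>x\<parallel>\<close> is small with \<open>\<delta>\<close>.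

  For a super strongly nonexpansive map, consecutive differences of an orbit are asymptotically
  equal, so \<open>k\<close> steps move a point by almost \<open>k d\<close>, where \<open>d\<close> is the limit of the step lengths;
  approximate fixed points force the displacement to be sublinear in \<open>k\<close>, whence \<open>d = 0\<close>.
\<close>

text \<open>For nonexpansive \<open>T\<close> this says that the limsup of
  \<open>norm (T x) - norm x\<close> as \<open>norm x\<close> tends to infinity is at most 0. The
  squared form suits expansion by inner products.\<close>

definition asymptotically_norm_nonincreasing :: "('a::real_inner \<Rightarrow> 'a) \<Rightarrow> bool" where
  "asymptotically_norm_nonincreasing T \<longleftrightarrow>
     (\<forall>\<epsilon>>0. \<exists>C. \<forall>x. (norm (T x))\<^sup>2 \<le> (norm x)\<^sup>2 + \<epsilon> * norm x + C)"

section \<open>Nonexpansive maps and composition\<close>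

lemma nonexpansiveD: "nonexpansive T \<Longrightarrow> norm (T x - T y) \<le> norm (x - y)"
  by (simp add: nonexpansive_def)

lemma nonexpansive_norm_le:
  assumes "nonexpansive T"
  shows "norm (T x) \<le> norm x + norm (T 0)"
  using nonexpansiveD[OF assms, of x 0] norm_triangle_sub[of "T x" "T 0"] by simp

lemma nonexpansive_comp: "nonexpansive S \<Longrightarrow> nonexpansive T \<Longrightarrow> nonexpansive (S \<circ> T)"
  unfolding nonexpansive_def comp_def by (blast intro: order_trans)

lemma nonexpansive_funpow: "nonexpansive T \<Longrightarrow> nonexpansive (T ^^ n)"
  by (induction n) (auto intro: nonexpansive_comp simp: nonexpansive_def[of id])

lemma super_strongly_nonexpansive_nonexpansive:
  "super_strongly_nonexpansive T \<Longrightarrow> nonexpansive T"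
  by (simp add: super_strongly_nonexpansive_def)

lemma super_strongly_nonexpansiveD:
  assumes "super_strongly_nonexpansive T"
    and "(\<lambda>n. (norm (x n - y n))\<^sup>2 - (norm (T (x n) - T (y n)))\<^sup>2) \<longlonglongrightarrow> 0"
  shows "(\<lambda>n. (x n - y n) - (T (x n) - T (y n))) \<longlonglongrightarrow> 0"
  using assms by (auto simp: super_strongly_nonexpansive_def)

text \<open>The drop of the squared distance under \<open>S \<circ> T\<close> is the sum of two
  nonnegative drops, one for each map, so both tend to 0 when the sum does.\<close>

lemma super_strongly_nonexpansive_comp:
  assumes S: "super_strongly_nonexpansive S" and T: "super_strongly_nonexpansive T"
  shows "super_strongly_nonexpansive (S \<circ> T)"
  unfolding super_strongly_nonexpansive_def
proof (intro conjI allI impI)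
  note neS = super_strongly_nonexpansive_nonexpansive[OF S]
  note neT = super_strongly_nonexpansive_nonexpansive[OF T]
  show "nonexpansive (S \<circ> T)"
    using neS neT by (rule nonexpansive_comp)
  fix x y :: "nat \<Rightarrow> 'a"
  assume lim: "(\<lambda>n. (norm (x n - y n))\<^sup>2 - (norm ((S \<circ> T) (x n) - (S \<circ> T) (y n)))\<^sup>2) \<longlonglongrightarrow> 0"
  have sqS: "(norm (S u - S v))\<^sup>2 \<le> (norm (u - v))\<^sup>2" for u v
    by (intro power_mono nonexpansiveD[OF neS]) simp
  have sqT: "(norm (T u - T v))\<^sup>2 \<le> (norm (u - v))\<^sup>2" for u v
    by (intro power_mono nonexpansiveD[OF neT]) simp
  have "(\<lambda>n. (norm (x n - y n))\<^sup>2 - (norm (T (x n) - T (y n)))\<^sup>2) \<longlonglongrightarrow> 0"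
    by (rule tendsto_sandwich[OF _ _ tendsto_const lim]) (auto simp: sqS sqT)
  note 1 = super_strongly_nonexpansiveD[OF T this]
  have "(\<lambda>n. (norm (T (x n) - T (y n)))\<^sup>2 - (norm (S (T (x n)) - S (T (y n))))\<^sup>2) \<longlonglongrightarrow> 0"
    by (rule tendsto_sandwich[OF _ _ tendsto_const lim]) (auto simp: sqS sqT)
  note 2 = super_strongly_nonexpansiveD[OF S this]
  show "(\<lambda>n. (x n - y n) - ((S \<circ> T) (x n) - (S \<circ> T) (y n))) \<longlonglongrightarrow> 0"
    using tendsto_add[OF 1 2] by (simp add: algebra_simps)
qed

section \<open>Norm growth under supercoercivity\<close>

lemma supercoercively_SSNE_growth:
  assumes T: "supercoercively_SSNE T"
  shows "\<exists>C. \<forall>x y. K * norm ((x - y) - (T x - T y)) \<le> (norm (x - y))\<^sup>2 - (norm (T x - T y))\<^sup>2 + C"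
proof -
  from T obtain \<psi> where mod: "SSNE_modulus \<psi> T" and lim: "filterlim (\<lambda>s. \<psi> s / s) at_top at_top"
    and ne: "nonexpansive T"
    by (auto simp: supercoercively_SSNE_def super_strongly_nonexpansive_def)
  obtain r where r: "\<And>s. s \<ge> r \<Longrightarrow> K \<le> \<psi> s / s"
    using lim unfolding filterlim_at_top eventually_at_top_linorder by meson
  have "K * norm ((x - y) - (T x - T y)) \<le> (norm (x - y))\<^sup>2 - (norm (T x - T y))\<^sup>2 + \<bar>K\<bar> * \<bar>r\<bar>" for x y
  proof -
    define s where "s = norm ((x - y) - (T x - T y))"
    define D where "D = (norm (x - y))\<^sup>2 - (norm (T x - T y))\<^sup>2"
    have D0: "0 \<le> D"
      using nonexpansiveD[OF ne, of x y] by (simp add: D_def power_mono)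
    have "K * s \<le> D + \<bar>K\<bar> * \<bar>r\<bar>"
    proof (cases "s > 0 \<and> s \<ge> r")
      case True
      \<comment> \<open>Contrapositive of the modulus property at \<epsilon> = \<open>s\<close>: the
        norm in question equals \<open>s\<close>, so it is not below \<open>s\<close>.\<close>
      then have "\<psi> s \<le> D"
        using mod unfolding SSNE_modulus_def s_def D_def by (meson less_irrefl not_le)
      moreover have "K * s \<le> \<psi> s"
        using r[of s] True by (simp add: pos_le_divide_eq)
      ultimately show ?thesis
        by (smt (verit) mult_nonneg_nonneg)
    next
      case False
      moreover have "s \<ge> 0"
        by (simp add: s_def)
      ultimately have "\<bar>K * s\<bar> \<le> \<bar>K\<bar> * \<bar>r\<bar>"
        unfolding abs_mult by (intro mult_left_mono) auto
      with D0 show ?thesis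
        by linarith
    qed
    then show ?thesis
      by (simp add: s_def D_def)
  qed
  then show ?thesis
    by blast
qed

lemma supercoercively_SSNE_asymptotically_norm_nonincreasing:
  assumes T: "supercoercively_SSNE T" and fp: "approx_fixed_point_property T"
  shows "asymptotically_norm_nonincreasing T"
  unfolding asymptotically_norm_nonincreasing_def
proof (intro allI impI)
  fix \<epsilon> :: real
  assume "\<epsilon> > 0"
  then obtain p where p: "norm (p - T p) \<le> \<epsilon> / 2"
    using fp by (meson approx_fixed_point_property_def half_gt_zero)
  have ne: "nonexpansive T"
    using T by (simp add: supercoercively_SSNE_def super_strongly_nonexpansive_def)
  \<comment> \<open>The factor \<open>2 * norm p\<close> is what Cauchy-Schwarz produces below for
    \<open>2 * inner (x - T x) p\<close>, so the two terms cancel.\<close>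
  obtain C where C: "\<And>x y. 2 * norm p * norm ((x - y) - (T x - T y))
      \<le> (norm (x - y))\<^sup>2 - (norm (T x - T y))\<^sup>2 + C"
    using supercoercively_SSNE_growth[OF T] by meson
  have "(norm (T x))\<^sup>2 \<le> (norm x)\<^sup>2 + \<epsilon> * norm x
      + (C + norm p * \<epsilon> + \<epsilon> * norm (T 0) + (norm p)\<^sup>2)" for x
  proof -
    have eq: "(norm (x - p))\<^sup>2 - (norm (T x - T p))\<^sup>2 = (norm x)\<^sup>2 - (norm (T x))\<^sup>2
        - 2 * inner (x - T x) p - 2 * inner (T x) (p - T p) + (norm p)\<^sup>2 - (norm (T p))\<^sup>2"
      by (simp add: power2_norm_eq_inner inner_diff_left inner_diff_right inner_commute)
    have "norm (x - T x) \<le> norm ((x - p) - (T x - T p)) + \<epsilon> / 2"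
      using p norm_triangle_ineq[of "(x - p) - (T x - T p)" "p - T p"] by simp
    then have "norm (x - T x) * norm p \<le> (norm ((x - p) - (T x - T p)) + \<epsilon> / 2) * norm p"
      by (intro mult_right_mono) auto
    then have 1: "- 2 * inner (x - T x) p
        \<le> 2 * norm p * norm ((x - p) - (T x - T p)) + norm p * \<epsilon>"
      using Cauchy_Schwarz_ineq2[of "x - T x" p] by (simp add: algebra_simps)
    have "- inner (T x) (p - T p) \<le> norm (T x) * norm (p - T p)"
      using Cauchy_Schwarz_ineq2[of "T x" "p - T p"] by linarith
    also have "\<dots> \<le> (norm x + norm (T 0)) * (\<epsilon> / 2)"
      using p nonexpansive_norm_le[OF ne] by (intro mult_mono) auto
    finally have 2: "- 2 * inner (T x) (p - T p) \<le> \<epsilon> * norm x + \<epsilon> * norm (T 0)"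
      by (simp add: algebra_simps)
    from C[of x p] eq 1 2 show ?thesis
      using zero_le_power2[of "norm (T p)"] by linarith
  qed
  then show "\<exists>C. \<forall>x. (norm (T x))\<^sup>2 \<le> (norm x)\<^sup>2 + \<epsilon> * norm x + C"
    by blast
qed

text \<open>Each map gets half of \<epsilon>. Nonexpansiveness of \<open>T\<close> turns the term
  linear in \<open>norm (T x)\<close> into one linear in \<open>norm x\<close>, up to a
  constant.\<close>

lemma asymptotically_norm_nonincreasing_comp:
  assumes S: "asymptotically_norm_nonincreasing S" and T: "asymptotically_norm_nonincreasing T"
    and ne: "nonexpansive T"
  shows "asymptotically_norm_nonincreasing (S \<circ> T)"
  unfolding asymptotically_norm_nonincreasing_def
proof (intro allI impI)
  fix \<epsilon> :: real
  assume e: "\<epsilon> > 0"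
  obtain C where C: "\<And>x. (norm (S x))\<^sup>2 \<le> (norm x)\<^sup>2 + \<epsilon> / 2 * norm x + C"
    using S e unfolding asymptotically_norm_nonincreasing_def by (meson half_gt_zero)
  obtain D where D: "\<And>x. (norm (T x))\<^sup>2 \<le> (norm x)\<^sup>2 + \<epsilon> / 2 * norm x + D"
    using T e unfolding asymptotically_norm_nonincreasing_def by (meson half_gt_zero)
  have "(norm ((S \<circ> T) x))\<^sup>2 \<le> (norm x)\<^sup>2 + \<epsilon> * norm x + (C + D + \<epsilon> / 2 * norm (T 0))" for x
  proof -
    have "\<epsilon> / 2 * norm (T x) \<le> \<epsilon> / 2 * (norm x + norm (T 0))"
      using e nonexpansive_norm_le[OF ne] by (intro mult_left_mono) auto
    with C[of "T x"] D[of x] show ?thesis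
      by (simp add: distrib_left)
  qed
  then show "\<exists>C. \<forall>x. (norm ((S \<circ> T) x))\<^sup>2 \<le> (norm x)\<^sup>2 + \<epsilon> * norm x + C"
    by blast
qed

section \<open>Approximate fixed points from the norm bound\<close>

text \<open>Dividing \<open>T\<close> by \<open>1 + \<delta>\<close> gives a contraction, which has
  a fixed point by Banach's theorem.\<close>

lemma nonexpansive_scaled_fixed_point:
  fixes T :: "'a::{real_inner, complete_space} \<Rightarrow> 'a"
  assumes ne: "nonexpansive T" and "\<delta> > 0"
  shows "\<exists>x. T x = (1 + \<delta>) *\<^sub>R x"
proof -
  let ?c = "inverse (1 + \<delta>)"
  have c: "0 \<le> ?c" "?c < 1"
    using \<open>\<delta> > 0\<close> by (auto simp: field_simps)
  have "\<forall>x y. dist (?c *\<^sub>R T x) (?c *\<^sub>R T y) \<le> ?c * dist x y"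
    using c(1) nonexpansiveD[OF ne]
    by (auto simp: dist_norm mult_left_mono simp flip: scaleR_diff_right)
  then obtain x where x: "?c *\<^sub>R T x = x"
    using banach_fix_type[OF c, of "\<lambda>x. ?c *\<^sub>R T x"] by blast
  have "T x = (1 + \<delta>) *\<^sub>R ?c *\<^sub>R T x"
    using \<open>\<delta> > 0\<close> by simp
  then show ?thesis
    unfolding x by (rule exI)
qed

lemma asymptotically_norm_nonincreasing_approx_fixed_point:
  fixes T :: "'a::{real_inner, complete_space} \<Rightarrow> 'a"
  assumes ne: "nonexpansive T" and T: "asymptotically_norm_nonincreasing T"
  shows "approx_fixed_point_property T"
  unfolding approx_fixed_point_property_def
proof (intro allI impI)
  fix \<epsilon> :: real
  assume e: "\<epsilon> > 0"
  obtain C where C: "\<And>x. (norm (T x))\<^sup>2 \<le> (norm x)\<^sup>2 + \<epsilon> * norm x + C"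
    using T e unfolding asymptotically_norm_nonincreasing_def by meson
  \<comment> \<open>Chosen so that \<open>\<delta> * C\<close> is at most the square of \<epsilon>;
    the summand 1 keeps the denominator positive.\<close>
  define \<delta> where "\<delta> = \<epsilon>\<^sup>2 / (\<bar>C\<bar> + 1)"
  have d: "\<delta> > 0"
    using e by (simp add: \<delta>_def divide_pos_pos add_nonneg_pos)
  have "\<delta> * C \<le> \<delta> * (\<bar>C\<bar> + 1)"
    using d by (intro mult_left_mono) auto
  also have "\<dots> = \<epsilon>\<^sup>2"
    by (simp add: \<delta>_def)
  finally have dC: "\<delta> * C \<le> \<epsilon>\<^sup>2" .
  obtain x where x: "T x = (1 + \<delta>) *\<^sub>R x"
    using nonexpansive_scaled_fixed_point[OF ne d] by blast
  define t where "t = \<delta> * norm x"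
  have "(norm (T x))\<^sup>2 = (norm x + t)\<^sup>2"
    using d by (simp add: x t_def distrib_right)
  then have "2 * norm x * t \<le> \<epsilon> * norm x + C"
    using C[of x] zero_le_power2[of t] unfolding power2_sum by linarith
  \<comment> \<open>Multiplying by \<delta> turns each \<open>norm x\<close> into \<open>t\<close>;
    the resulting quadratic inequality in \<open>t\<close> fails for
    \<open>t > \<epsilon>\<close>.\<close>
  then have "\<delta> * (2 * norm x * t) \<le> \<delta> * (\<epsilon> * norm x + C)"
    using d by (intro mult_left_mono) auto
  then have "2 * t\<^sup>2 \<le> \<epsilon> * t + \<epsilon>\<^sup>2"
    using dC by (simp add: t_def algebra_simps power2_eq_square)
  moreover have "\<epsilon> * t < t\<^sup>2" "\<epsilon>\<^sup>2 < t\<^sup>2" if "t > \<epsilon>"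
    using that e by (auto simp: power2_eq_square intro: mult_strict_mono)
  ultimately have "t \<le> \<epsilon>"
    by linarith
  moreover have "norm (x - T x) = t"
    using d by (simp add: x t_def scaleR_left_distrib)
  ultimately show "\<exists>p. norm (p - T p) \<le> \<epsilon>"
    by metis
qed

section \<open>Asymptotic regularity\<close>

lemma nonexpansive_funpow_displacement:
  assumes ne: "nonexpansive T"
  shows "norm ((T ^^ n) p - p) \<le> real n * norm (p - T p)"
proof (induction n)
  case (Suc n)
  have "norm ((T ^^ Suc n) p - p) \<le> norm (T ((T ^^ n) p) - T p) + norm (T p - p)"
    using norm_triangle_ineq[of "T ((T ^^ n) p) - T p" "T p - p"] by simp
  also have "\<dots> \<le> norm ((T ^^ n) p - p) + norm (p - T p)"
    using nonexpansiveD[OF ne] by (simp add: norm_minus_commute)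
  finally show ?case
    using Suc by (simp add: algebra_simps)
qed simp

lemma super_strongly_nonexpansive_asymptotically_regular:
  assumes T: "super_strongly_nonexpansive T" and fp: "approx_fixed_point_property T"
  shows "asymptotically_regular T"
  unfolding asymptotically_regular_def
proof (intro allI)
  fix x
  have ne: "nonexpansive T"
    using T by (rule super_strongly_nonexpansive_nonexpansive)
  define v where "v = (\<lambda>n. (T ^^ n) x - (T ^^ Suc n) x)"
  have "decseq (\<lambda>n. norm (v n))"
    unfolding decseq_Suc_iff using nonexpansiveD[OF ne] by (simp add: v_def)
  then obtain d where d: "(\<lambda>n. norm (v n)) \<longlonglongrightarrow> d" and d_le: "\<And>n. d \<le> norm (v n)"
    using decseq_convergent[of "\<lambda>n. norm (v n)" 0] by auto
  have d0: "d \<ge> 0"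
    using d by (rule LIMSEQ_le_const) auto
  \<comment> \<open>Both squared norms have the same limit, so super strong nonexpansiveness applies
    to the orbit and its shift.\<close>
  have "(\<lambda>n. (norm (v n))\<^sup>2 - (norm (v (Suc n)))\<^sup>2) \<longlonglongrightarrow> d\<^sup>2 - d\<^sup>2"
    by (intro tendsto_intros d LIMSEQ_Suc[OF d])
  then have v_Suc: "(\<lambda>n. v n - v (Suc n)) \<longlonglongrightarrow> 0"
    using super_strongly_nonexpansiveD[OF T, of "\<lambda>n. (T ^^ n) x" "\<lambda>n. (T ^^ Suc n) x"]
    by (simp add: v_def)
  have v_add: "(\<lambda>n. v n - v (n + k)) \<longlonglongrightarrow> 0" for k
  proof (induction k)
    case (Suc k)
    show ?case
      using tendsto_add[OF Suc LIMSEQ_ignore_initial_segment[OF v_Suc, of k]] by simp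
  qed simp
  \<comment> \<open>The displacement over \<open>k\<close> steps is the sum of
    \<open>v (n + j)\<close> for \<open>j < k\<close>, and each summand is asymptotically
    \<open>v n\<close>.\<close>
  have steps: "(\<lambda>n. real k *\<^sub>R v n - ((T ^^ n) x - (T ^^ (n + k)) x)) \<longlonglongrightarrow> 0" for k
  proof (induction k)
    case (Suc k)
    show ?case
      using tendsto_add[OF Suc v_add[of k]] by (simp add: v_def algebra_simps)
  qed simp
  \<comment> \<open>With \<open>k\<close> fixed and \<open>n\<close> tending to infinity,
    nonexpansiveness of \<open>T ^^ n\<close> carries the displacement far along the orbit back to
    its start.\<close>
  have bound: "real k * d \<le> norm (x - (T ^^ k) x)" for k
  proof (rule LIMSEQ_le)
    show "(\<lambda>n. norm (real k *\<^sub>R v n)) \<longlonglongrightarrow> real k * d"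
      using tendsto_mult[OF tendsto_const d, of "real k"] by simp
    show "(\<lambda>n. norm (real k *\<^sub>R v n - ((T ^^ n) x - (T ^^ (n + k)) x)) + norm (x - (T ^^ k) x))
        \<longlonglongrightarrow> norm (x - (T ^^ k) x)"
      by (rule tendsto_eq_intros refl tendsto_norm steps)+ simp
    have "norm (real k *\<^sub>R v n)
        \<le> norm (real k *\<^sub>R v n - ((T ^^ n) x - (T ^^ (n + k)) x)) + norm (x - (T ^^ k) x)" for n
    proof -
      have "norm ((T ^^ n) x - (T ^^ (n + k)) x) \<le> norm (x - (T ^^ k) x)"
        using nonexpansiveD[OF nonexpansive_funpow[OF ne, of n]] by (simp add: funpow_add)
      then show ?thesis
        using norm_triangle_sub[of "real k *\<^sub>R v n" "(T ^^ n) x - (T ^^ (n + k)) x"] by simp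
    qed
    then show "\<exists>N. \<forall>n\<ge>N. norm (real k *\<^sub>R v n)
        \<le> norm (real k *\<^sub>R v n - ((T ^^ n) x - (T ^^ (n + k)) x)) + norm (x - (T ^^ k) x)"
      by blast
  qed
  have "d \<le> \<epsilon>" if e: "\<epsilon> > 0" for \<epsilon>
  proof (rule ccontr)
    assume "\<not> d \<le> \<epsilon>"
    obtain p where p: "norm (p - T p) \<le> \<epsilon>"
      using fp e by (meson approx_fixed_point_property_def)
    \<comment> \<open>Comparison with the orbit of \<open>p\<close> gives
      \<open>real k * d \<le> 2 * norm (x - p) + real k * \<epsilon>\<close>, which a large
      \<open>k\<close> violates.\<close>
    obtain k where k: "2 * norm (x - p) < real k * (d - \<epsilon>)"
      using reals_Archimedean3[of "d - \<epsilon>"] \<open>\<not> d \<le> \<epsilon>\<close> by auto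
    have "x - (T ^^ k) x = (x - p) - ((T ^^ k) p - p) - ((T ^^ k) x - (T ^^ k) p)"
      by simp
    also have "norm \<dots> \<le> norm (x - p) + norm ((T ^^ k) p - p) + norm ((T ^^ k) x - (T ^^ k) p)"
      by (meson norm_triangle_ineq4 add_right_mono order_trans)
    also have "\<dots> \<le> norm (x - p) + real k * \<epsilon> + norm (x - p)"
      using nonexpansive_funpow_displacement[OF ne, of k p] mult_left_mono[OF p, of "real k"]
        nonexpansiveD[OF nonexpansive_funpow[OF ne, of k], of x p]
      by linarith
    finally show False
      using bound[of k] k by (simp add: algebra_simps)
  qed
  with d0 have "d = 0"
    using field_le_epsilon[of d 0] by simp
  with d show "(\<lambda>n. norm ((T ^^ n) x - (T ^^ Suc n) x)) \<longlonglongrightarrow> 0"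
    by (simp add: v_def)
qed

theorem theorem4p10:
  fixes R :: "nat \<Rightarrow> 'a::{real_inner, complete_space} \<Rightarrow> 'a" and m :: nat
  assumes "m \<ge> 1"
    and "\<And>i. i \<in> {1..m} \<Longrightarrow> supercoercively_SSNE (R i)"
    and "\<And>i. i \<in> {1..m} \<Longrightarrow> approx_fixed_point_property (R i)"
  shows "asymptotically_regular (composition_upto R m)"
proof -
  \<comment> \<open>The induction carries the norm bound because it passes to compositions directly;
    approximate fixed points are recovered only at the end.\<close>
  have "super_strongly_nonexpansive (composition_upto R k) \<and>
      asymptotically_norm_nonincreasing (composition_upto R k)" if "k \<le> m" for k
    using that
  proof (induction k)
    case 0
    show ?case
      by (auto simp: super_strongly_nonexpansive_def nonexpansive_def
          asymptotically_norm_nonincreasing_def intro: exI[of _ 0])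
  next
    case (Suc k)
    then have R: "supercoercively_SSNE (R (Suc k))" "approx_fixed_point_property (R (Suc k))"
      using assms by auto
    then have "super_strongly_nonexpansive (R (Suc k))"
      by (simp add: supercoercively_SSNE_def)
    with Suc R show ?case
      unfolding composition_upto.simps
      using supercoercively_SSNE_asymptotically_norm_nonincreasing[OF R]
      by (simp add: super_strongly_nonexpansive_comp asymptotically_norm_nonincreasing_comp
          super_strongly_nonexpansive_nonexpansive del: comp_apply)
  qed
  then show ?thesis
    by (simp add: super_strongly_nonexpansive_asymptotically_regular
        asymptotically_norm_nonincreasing_approx_fixed_point
        super_strongly_nonexpansive_nonexpansive)
qed

end
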